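(* Let $n\ge 1$, and let $Y_1,\dots,Y_n$ with $r$-dimensional covariates be a sample from a ULARMA$(p,q)$ model with parameter vector $\boldsymbol\gamma=(\alpha,\boldsymbol\beta',\boldsymbol\phi',\boldsymbol\theta')'\in\Omega\subset\mathbb{R}^{r+p+q+1}$ (as defined in the context), and let $\ell(\boldsymbol\gamma)=\sum_{t=1}^n\ell_t(\boldsymbol\gamma)$ be the partial log-likelihood. Then the partial score vector $U(\boldsymbol\gamma)=\partial\ell(\boldsymbol\gamma)/\partial\boldsymbol\gamma$ is $$U(\boldsymbol\gamma)=D'\,T\,\boldsymbol h,$$ where $D$ is the $n\times(p+q+r+1)$ matrix with $[D]_{i,j}=\partial\eta_i/\partial\gamma_j$, $T=\mathrm{diag}\{1/g'(\mu_1),\dots,1/g'(\mu_n)\}$, and $\boldsymbol h=(h_1,\dots,h_n)'$ with $$h_t=\frac{\partial\ell_t(\boldsymbol\gamma)}{\partial\mu_t}=-\frac{2}{1-\mu_t}-\frac1{\mu_t}+\frac{Y_t}{\mu_t^2(1-Y_t)} .$$ Moreover, for $t\ge1$, the entries of $D$ satisfy the recursions $$\frac{\partial\eta_t}{\partial\alpha}=1-\sum_{j=1}^q\theta_j\frac{\partial\eta_{t-j}}{\partial\alpha},\qquad \frac{\partial\eta_t}{\partial\beta_l}=X_{tl}-\sum_{i=1}^p\phi_iX_{(t-i)l}-\sum_{j=1}^q\theta_j\frac{\partial\eta_{t-j}}{\partial\beta_l},$$ $$\frac{\partial\eta_t}{\partial\phi_k}=g(Y_{t-k})-\boldsymbol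 X_{t-k}'\boldsymbol\beta-\sum_{j=1}^q\theta_j\frac{\partial\eta_{t-j}}{\partial\phi_k},\qquad \frac{\partial\eta_t}{\partial\theta_s}=r_{t-s}-\sum_{i=1}^q\theta_i\frac{\partial\eta_{t-i}}{\partial\theta_s},$$ for $l\in\{1,\dots,r\}$, $k\in\{1,\dots,p\}$, $s\in\{1,\dots,q\}$, with the convention that $\partial\eta_t/\partial\gamma_j=0$ for $t\le0$, where $X_{tl}$ is the $l$-th component of $\boldsymbol X_t$.
   Context: ULARMA$(p,q)$ model: $\{Y_t\}$ is a $(0,1)$-valued process, $\{\boldsymbol X_t\}$ an $\mathbb{R}^r$-valued sequence of covariates, $\mathcal{F}_t=\sigma\{\boldsymbol X_{t+1},Y_t,\boldsymbol X_t,Y_{t-1},\dots\}$. The link $g:(0,1)\to\mathbb{R}$ is a twice differentiable bijection with $g'\neq0$ everywhere. The parameters are $\alpha\in\mathbb{R}$, $\boldsymbol\beta=(\beta_1,\dots,\beta_r)'$, $\boldsymbol\phi=(\phi_1,\dots,\phi_p)'$, $\boldsymbol\theta=(\theta_1,\dots,\theta_q)'$. Conditionally, $Y_t\mid\mathcal{F}_{t-1}$ has the Unit-Lindley distribution $\mathrm{UL}(\mu_t)$, with density $f(y;\mu)=\frac{(1-\mu)^2}{\mu(1-y)^3}\exp\left\{\frac{y(\mu-1)}{\mu(1-y)}\right\}$ on $0<y<1$ at $\mu=\mu_t\in(0,1)$, where for $t\ge1$ $$\eta_t=g(\mu_t)=\alpha+\boldsymbol X_t'\boldsymbol\beta+\sum_{i=1}^p\phi_i\big[g(Y_{t-i})-\boldsymbol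 X_{t-i}'\boldsymbol\beta\big]+\sum_{j=1}^q\theta_j r_{t-j},\qquad r_t=g(Y_t)-g(\mu_t).$$ Initialization: the pre-sample values $Y_t,\boldsymbol X_t$ ($t\le0$) are treated as given and not depending on $\boldsymbol\gamma$, and $r_t=0$ for $t\le0$. Thus for $t\ge1$, $\eta_t$ and $\mu_t=g^{-1}(\eta_t)$ are functions of $\boldsymbol\gamma$ and the data. The partial log-likelihood terms are $$\ell_t(\boldsymbol\gamma)=2\ln(1-\mu_t)-\ln(\mu_t)-3\ln(1-Y_t)+\frac{Y_t(\mu_t-1)}{\mu_t(1-Y_t)},\qquad 1\le t\le n,$$ and $\partial\ell_t/\partial\mu_t$ denotes the derivative of this expression in $\mu_t$ with $Y_t$ held fixed. A prime on a vector or matrix denotes transpose; $g'$ denotes the derivative of $g$. *)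

theory Defs
  imports "HOL-Probability.Probability" "Jordan_Normal_Form.Matrix"
begin

unbundle no vec_syntax
hide_const (open) Finite_Cartesian_Product.vec Finite_Cartesian_Product.mat
hide_type (open) Finite_Cartesian_Product.vec

text \<open>
  All dimensions are natural numbers (possibly \<open>0\<close> for \<open>r\<close>, \<open>p\<close>, \<open>q\<close>).
  The parameter vector \<open>\<gamma> = (\<alpha>, \<beta>', \<phi>', \<theta>')'\<close> is a vector of dimension \<open>1 + r + p + q\<close>
  whose entries are indexed from \<open>0\<close>.
  The lag indices of \<open>\<phi>\<close> and \<open>\<theta>\<close> start at \<open>1\<close>; the components of \<open>\<beta>\<close> and of the
  covariates are indexed from \<open>0\<close>, as in the vector library.
\<close>

definition alpha_coef :: "real vec \<Rightarrow> real" where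
  "alpha_coef \<gamma> = \<gamma> $ 0"

definition beta_coef :: "nat \<Rightarrow> real vec \<Rightarrow> real vec" where
  "beta_coef r \<gamma> = vec r (\<lambda>l. \<gamma> $ (1 + l))"

definition phi_coef :: "nat \<Rightarrow> real vec \<Rightarrow> nat \<Rightarrow> real" where
  "phi_coef r \<gamma> i = \<gamma> $ (r + i)"

definition theta_coef :: "nat \<Rightarrow> nat \<Rightarrow> real vec \<Rightarrow> nat \<Rightarrow> real" where
  "theta_coef r p \<gamma> j = \<gamma> $ (r + p + j)"


definition link_function :: "(real \<Rightarrow> real) \<Rightarrow> bool" where
  "link_function g \<longleftrightarrow>
     bij_betw g {0<..<1} UNIV \<and>
     (\<forall>m\<in>{0<..<1}. g field_differentiable at m \<and> deriv g field_differentiable at m \<and>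
                     deriv g m \<noteq> 0)"

definition inv_link :: "(real \<Rightarrow> real) \<Rightarrow> real \<Rightarrow> real" where
  "inv_link g = the_inv_into {0<..<1} g"


definition partially_differentiable :: "(real vec \<Rightarrow> real) \<Rightarrow> real vec \<Rightarrow> nat \<Rightarrow> bool" where
  "partially_differentiable f \<gamma> j \<longleftrightarrow>
     (\<lambda>s. f (\<gamma> |\<^sub>v j \<mapsto> s)) field_differentiable at (\<gamma> $ j)"

definition partial_deriv :: "(real vec \<Rightarrow> real) \<Rightarrow> real vec \<Rightarrow> nat \<Rightarrow> real" where
  "partial_deriv f \<gamma> j = deriv (\<lambda>s. f (\<gamma> |\<^sub>v j \<mapsto> s)) (\<gamma> $ j)"


definition ul_density :: "real \<Rightarrow> real \<Rightarrow> real" where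
  "ul_density m y =
     (if 0 < y \<and> y < 1
      then (1 - m)\<^sup>2 / (m * (1 - y) ^ 3) * exp (y * (m - 1) / (m * (1 - y)))
      else 0)"

definition ul_loglik :: "real \<Rightarrow> real \<Rightarrow> real" where
  "ul_loglik y m =
     2 * ln (1 - m) - ln m - 3 * ln (1 - y) + y * (m - 1) / (m * (1 - y))"

lemma ul_loglik_eq_ln_density:
  assumes "0 < m" "m < 1" "0 < y" "y < 1"
  shows "ul_loglik y m = ln (ul_density m y)"
  using assms
  by (simp add: ul_loglik_def ul_density_def ln_mult ln_div ln_realpow)


text \<open>
  Below, \<open>x\<close> and \<open>y\<close> are one realisation of the covariates and of the series, indexed by
  integer times; the values at times \<open>t \<le> 0\<close> are the given pre-sample values.
  The values of \<open>eta\<close> and \<open>mu\<close> are relevant only for \<open>t \<ge> 1\<close>.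
\<close>

context
  fixes g :: "real \<Rightarrow> real" and r p q :: nat
    and x :: "int \<Rightarrow> real vec" and y :: "int \<Rightarrow> real"
begin

function eta :: "int \<Rightarrow> real vec \<Rightarrow> real" and resid :: "int \<Rightarrow> real vec \<Rightarrow> real" where
  "eta t \<gamma> =
     alpha_coef \<gamma> + x t \<bullet> beta_coef r \<gamma>
     + (\<Sum>i\<in>{1..p}. phi_coef r \<gamma> i * (g (y (t - int i)) - x (t - int i) \<bullet> beta_coef r \<gamma>))
     + (\<Sum>j\<in>{1..q}. theta_coef r p \<gamma> j * resid (t - int j) \<gamma>)"
| "resid t \<gamma> = (if t \<le> 0 then 0 else g (y t) - g (inv_link g (eta t \<gamma>)))"
  by pat_completeness auto
termination
  by (relation "Wellfounded.measure (case_sum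
        (\<lambda>(t, _). if t \<le> 0 then 1 else 2 * nat t)
        (\<lambda>(t, _). if t \<le> 0 then 0 else 2 * nat t + 1))") auto

declare eta.simps [simp del] resid.simps [simp del]

definition mu :: "int \<Rightarrow> real vec \<Rightarrow> real" where
  "mu t \<gamma> = inv_link g (eta t \<gamma>)"

definition loglik :: "nat \<Rightarrow> real vec \<Rightarrow> real" where
  "loglik n \<gamma> = (\<Sum>t\<in>{1..n}. ul_loglik (y (int t)) (mu (int t) \<gamma>))"

definition score :: "nat \<Rightarrow> real vec \<Rightarrow> real vec" where
  "score n \<gamma> = vec (1 + r + p + q) (partial_deriv (loglik n) \<gamma>)"

text \<open>The partial derivatives of \<open>eta\<close>, with the convention that they vanish for \<open>t \<le> 0\<close>.\<close>

definition d_eta :: "int \<Rightarrow> real vec \<Rightarrow> nat \<Rightarrow> real" where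
  "d_eta t \<gamma> j = (if t \<le> 0 then 0 else partial_deriv (eta t) \<gamma> j)"

text \<open>Row (or entry) \<open>i\<close> of the following objects belongs to time \<open>i + 1\<close>.\<close>

definition D_mat :: "nat \<Rightarrow> real vec \<Rightarrow> real mat" where
  "D_mat n \<gamma> = mat n (1 + r + p + q) (\<lambda>(i, j). d_eta (int i + 1) \<gamma> j)"

definition T_mat :: "nat \<Rightarrow> real vec \<Rightarrow> real mat" where
  "T_mat n \<gamma> = mat_diag n (\<lambda>i. 1 / deriv g (mu (int i + 1) \<gamma>))"

definition h :: "int \<Rightarrow> real vec \<Rightarrow> real" where
  "h t \<gamma> = deriv (ul_loglik (y t)) (mu t \<gamma>)"

definition h_vec :: "nat \<Rightarrow> real vec \<Rightarrow> real vec" where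
  "h_vec n \<gamma> = vec n (\<lambda>i. h (int i + 1) \<gamma>)"

end


text \<open>The information \<open>\<F>\<^sub>t = \<sigma>{X\<^sub>t\<^sub>+\<^sub>1, Y\<^sub>t, X\<^sub>t, Y\<^sub>t\<^sub>-\<^sub>1, \<dots>}\<close>.\<close>

definition information ::
  "'a measure \<Rightarrow> nat \<Rightarrow> (int \<Rightarrow> 'a \<Rightarrow> real vec) \<Rightarrow> (int \<Rightarrow> 'a \<Rightarrow> real) \<Rightarrow> int \<Rightarrow> 'a measure" where
  "information M r X Y t = sigma (space M)
     ({(\<lambda>\<omega>. X s \<omega> $ l) -` B \<inter> space M | s l B. s \<le> t + 1 \<and> l < r \<and> B \<in> sets borel} \<union>
      {Y s -` B \<inter> space M | s B. s \<le> t \<and> B \<in> sets borel})"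

locale ularma = prob_space M for M :: "'a measure" +
  fixes g :: "real \<Rightarrow> real" and r p q :: nat
    and X :: "int \<Rightarrow> 'a \<Rightarrow> real vec" and Y :: "int \<Rightarrow> 'a \<Rightarrow> real" and \<gamma> :: "real vec"
  assumes link: "link_function g"
    and param: "\<gamma> \<in> carrier_vec (1 + r + p + q)"
    and X_dim: "\<And>t \<omega>. \<omega> \<in> space M \<Longrightarrow> X t \<omega> \<in> carrier_vec r"
    and X_measurable: "\<And>t l. l < r \<Longrightarrow> (\<lambda>\<omega>. X t \<omega> $ l) \<in> borel_measurable M"
    and Y_range: "\<And>t \<omega>. \<omega> \<in> space M \<Longrightarrow> Y t \<omega> \<in> {0<..<1}"
    and Y_measurable: "\<And>t. Y t \<in> borel_measurable M"
    and cond_distr: "\<And>t B. 1 \<le> t \<Longrightarrow> B \<in> sets borel \<Longrightarrow>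
          AE \<omega> in M.
            real_cond_exp M (information M r X Y (t - 1)) (indicator (Y t -` B \<inter> space M)) \<omega>
            = (LINT u:B|lborel. ul_density (mu g r p q (\<lambda>s. X s \<omega>) (\<lambda>s. Y s \<omega>) t \<gamma>) u)"

end

(* Since g (inv_link g u) = u for every real u, the residual at a time t >= 1 is
   g (y t) - eta t, so the link drops out of the recursion for eta: eta t is a polynomial in
   the parameters, and strong induction on t gives its partial derivatives. The link enters the
   score only through the chain rule for mu t = inv_link g (eta t), where the inverse function
   theorem supplies the factor 1 / g' (mu t). *)

theory Submission
  imports Defs
begin

section \<open>One-variable derivatives: inverse link, Unit-Lindley term, coordinate updates\<close>

lemma
  assumes "link_function g"
  shows inv_link_in: "inv_link g u \<in> {0<..<1}"
    and link_inv_link: "g (inv_link g u) = u"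
proof -
  have b: "bij_betw g {0<..<1} UNIV"
    using assms by (simp add: link_function_def)
  show "inv_link g u \<in> {0<..<1}"
    using bij_betwE[OF bij_betw_the_inv_into[OF b]] by (simp add: inv_link_def)
  show "g (inv_link g u) = u"
    unfolding inv_link_def by (rule f_the_inv_into_f_bij_betw[OF b]) simp
qed

lemma inv_link_has_real_derivative:
  assumes "link_function g"
  shows "(inv_link g has_real_derivative 1 / deriv g (inv_link g u)) (at u)"
proof -
  let ?m = "inv_link g u"
  have d: "(g has_real_derivative deriv g m) (at m)" if "m \<in> {0<..<1}" for m
    using assms that by (auto simp: link_function_def field_differentiable_derivI)
  have m: "?m \<in> {0<..<1}"
    by (rule inv_link_in[OF assms])
  have "(inv_link g has_real_derivative inverse (deriv g ?m)) (at (g ?m))"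
    unfolding has_field_derivative_def
  \<comment> \<open>This form of the inverse function theorem asks for continuity and a left inverse
    on the open interval, and for an invertible derivative at the single point \<open>?m\<close>.
    Continuity of \<open>inv_link g\<close> need not be shown beforehand.\<close>
  proof (rule has_derivative_inverse_strong[where S = "{0<..<1}" and f = g])
    show "continuous_on {0<..<1} g"
      using d by (intro DERIV_continuous_on) (auto intro: has_field_derivative_at_within)
    show "inv_link g (g z) = z" if "z \<in> {0<..<1}" for z
      using assms that unfolding inv_link_def link_function_def
      by (intro the_inv_into_f_f) (auto simp: bij_betw_def)
    show "(*) (deriv g ?m) \<circ> (*) (inverse (deriv g ?m)) = id"
      using m assms by (auto simp: link_function_def)
  qed (use d[OF m] m in \<open>auto simp: has_field_derivative_def\<close>)
  then show ?thesis
    by (simp add: link_inv_link[OF assms] inverse_eq_divide)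
qed

lemma ul_loglik_has_real_derivative:
  assumes "0 < m" "m < 1" "y < 1"
  shows "(ul_loglik y has_real_derivative
           - 2 / (1 - m) - 1 / m + y / (m\<^sup>2 * (1 - y))) (at m)"
proof -
  \<comment> \<open>In the quotient rule the numerator \<open>y * (m * c) - y * (m - 1) * c\<close>
    collapses to \<open>y * c\<close>, and one factor \<open>c\<close> cancels. Keeping
    \<open>c\<close> abstract turns \<open>1 - y\<close> into an atom for
    \<open>field_simps\<close>.\<close>
  have frac: "((\<lambda>m. y * (m - 1) / (m * c)) has_real_derivative y / (m\<^sup>2 * c)) (at m)"
    if "c \<noteq> 0" for c
    by (rule DERIV_cong[OF DERIV_divide[where D = y and E = c]])
      (use assms that in \<open>auto intro!: derivative_eq_intros simp: field_simps power2_eq_square\<close>)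
  have logs: "((\<lambda>m. 2 * ln (1 - m) - ln m - 3 * ln (1 - y)) has_real_derivative
      - 2 / (1 - m) - 1 / m) (at m)"
    using assms by (auto intro!: derivative_eq_intros)
  show ?thesis
    using DERIV_add[OF logs frac[of "1 - y"]] assms by (simp add: ul_loglik_def[abs_def])
qed

text \<open>As a function of \<open>s\<close> the entry is either constant or \<open>s\<close>
  itself. All coefficients thus get Kronecker deltas as partial derivatives, with \<open>j\<close>
  left open.\<close>

lemma DERIV_update_vec_index:
  assumes "k < dim_vec v"
  shows "((\<lambda>s. (v |\<^sub>v j \<mapsto> s) $ k) has_real_derivative of_bool (k = j)) (at z)"
  using assms by (cases "k = j") (auto intro!: derivative_eq_intros)

text \<open>With this, chain and product rules taken at \<open>s = \<gamma> $ j\<close> are read at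
  \<open>\<gamma>\<close> itself.\<close>

lemma update_vec_index_self [simp]: "v |\<^sub>v j \<mapsto> (v $ j) = (v :: 'a vec)"
  by (intro eq_vecI) (auto simp: update_vec_def)

section \<open>Partial derivatives of the linear predictor and their recursions\<close>

context
  fixes g :: "real \<Rightarrow> real" and r p q :: nat
    and x :: "int \<Rightarrow> real vec" and y :: "int \<Rightarrow> real"
  assumes link: "link_function g"
begin

lemma resid_eq: "resid g r p q x y t \<gamma> = (if t \<le> 0 then 0 else g (y t) - eta g r p q x y t \<gamma>)"
  by (simp add: resid.simps link_inv_link[OF link])

text \<open>The product rule applied to the formula of \<open>eta\<close>, uniformly in
  \<open>j\<close>: each \<open>of_bool\<close> is the partial derivative of one coefficient. The
  minus sign before \<open>theta_coef\<close> arises because a residual contains the earlier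
  \<open>eta\<close> negatively.\<close>

definition eta_deriv_rhs :: "int \<Rightarrow> real vec \<Rightarrow> nat \<Rightarrow> real" where
  "eta_deriv_rhs t \<gamma> j =
     of_bool (j = 0) + (\<Sum>l<r. x t $ l * of_bool (1 + l = j))
     + (\<Sum>i\<in>{1..p}. of_bool (r + i = j) * (g (y (t - int i)) - x (t - int i) \<bullet> beta_coef r \<gamma>)
          - phi_coef r \<gamma> i * (\<Sum>l<r. x (t - int i) $ l * of_bool (1 + l = j)))
     + (\<Sum>k\<in>{1..q}. of_bool (r + p + k = j) * resid g r p q x y (t - int k) \<gamma>
          - theta_coef r p \<gamma> k * d_eta g r p q x y (t - int k) \<gamma> j)"

text \<open>Stated for \<open>eta\<close> at every integer time: when \<open>t \<le> 0\<close> all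
  lagged residuals vanish identically, so the same induction step covers these times.\<close>

lemma eta_has_partial_derivative:
  assumes dim: "\<gamma> \<in> carrier_vec (1 + r + p + q)"
  shows "((\<lambda>s. eta g r p q x y t (\<gamma> |\<^sub>v j \<mapsto> s)) has_real_derivative eta_deriv_rhs t \<gamma> j)
           (at (\<gamma> $ j))"
proof (induction "nat t" arbitrary: t rule: less_induct)
  case less
  let ?u = "\<lambda>s. \<gamma> |\<^sub>v j \<mapsto> s"
  note upd = DERIV_update_vec_index[of _ \<gamma> j]
  have dim': "dim_vec \<gamma> = 1 + r + p + q"
    using dim by simp
  have a: "((\<lambda>s. alpha_coef (?u s)) has_real_derivative of_bool (j = 0)) (at (\<gamma> $ j))"
    using upd[of 0] dim' by (simp add: alpha_coef_def eq_commute[of 0 j])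
  have b: "((\<lambda>s. x t' \<bullet> beta_coef r (?u s)) has_real_derivative
             (\<Sum>l<r. x t' $ l * of_bool (1 + l = j))) (at (\<gamma> $ j))" for t'
  proof -
    \<comment> \<open>\<open>scalar_prod\<close> sums over the indices of its second argument, so
      the range is \<open>r\<close> by the definition of \<open>beta_coef\<close>.\<close>
    have "x t' \<bullet> beta_coef r (?u s) = (\<Sum>l<r. x t' $ l * ?u s $ (1 + l))" for s
      by (simp add: scalar_prod_def beta_coef_def lessThan_atLeast0)
    then show ?thesis
      by (simp only:) (intro DERIV_sum DERIV_cmult upd, simp add: dim')
  qed
  have f: "((\<lambda>s. phi_coef r (?u s) i) has_real_derivative of_bool (r + i = j)) (at (\<gamma> $ j))"
    if "i \<in> {1..p}" for i
    unfolding phi_coef_def using that dim' by (intro upd) auto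
  have th: "((\<lambda>s. theta_coef r p (?u s) k) has_real_derivative of_bool (r + p + k = j)) (at (\<gamma> $ j))"
    if "k \<in> {1..q}" for k
    unfolding theta_coef_def using that dim' by (intro upd) auto
  have res: "((\<lambda>s. resid g r p q x y (t - int k) (?u s)) has_real_derivative
               - d_eta g r p q x y (t - int k) \<gamma> j) (at (\<gamma> $ j))" if "k \<in> {1..q}" for k
  proof (cases "t - int k \<le> 0")
    \<comment> \<open>At a pre-sample lag the residual is constantly \<open>0\<close>, in agreement
      with the convention \<open>d_eta = 0\<close>.\<close>
    case True
    then show ?thesis by (simp add: resid_eq d_eta_def)
  next
    case False
    then have "nat (t - int k) < nat t"
      using that by auto
    \<comment> \<open>The induction hypothesis gives the derivative as \<open>eta_deriv_rhs\<close>;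
      uniqueness of derivatives identifies it with \<open>d_eta\<close>, which closes the
      recursion.\<close>
    from less[OF this] have *: "((\<lambda>s. eta g r p q x y (t - int k) (?u s)) has_real_derivative
        d_eta g r p q x y (t - int k) \<gamma> j) (at (\<gamma> $ j))"
      using False by (simp add: d_eta_def partial_deriv_def DERIV_imp_deriv)
    show ?thesis
      using DERIV_diff[OF DERIV_const[of "g (y (t - int k))"] *] False by (simp add: resid_eq)
  qed
  have phi_sum: "((\<lambda>s. \<Sum>i\<in>{1..p}. phi_coef r (?u s) i
         * (g (y (t - int i)) - x (t - int i) \<bullet> beta_coef r (?u s))) has_real_derivative
      (\<Sum>i\<in>{1..p}. of_bool (r + i = j) * (g (y (t - int i)) - x (t - int i) \<bullet> beta_coef r \<gamma>)
          - phi_coef r \<gamma> i * (\<Sum>l<r. x (t - int i) $ l * of_bool (1 + l = j)))) (at (\<gamma> $ j))"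
    by (rule DERIV_sum, rule DERIV_cong[OF DERIV_mult[OF f DERIV_diff[OF DERIV_const b]]])
      (simp_all add: algebra_simps)
  have theta_sum: "((\<lambda>s. \<Sum>k\<in>{1..q}. theta_coef r p (?u s) k
         * resid g r p q x y (t - int k) (?u s)) has_real_derivative
      (\<Sum>k\<in>{1..q}. of_bool (r + p + k = j) * resid g r p q x y (t - int k) \<gamma>
          - theta_coef r p \<gamma> k * d_eta g r p q x y (t - int k) \<gamma> j)) (at (\<gamma> $ j))"
    by (rule DERIV_sum, rule DERIV_cong[OF DERIV_mult[OF th res]]) (simp_all add: algebra_simps)
  show ?case
    unfolding eta_deriv_rhs_def eta.simps[of g r p q x y t]
    by (intro DERIV_add a b phi_sum theta_sum)
qed

lemma d_eta_eq:
  assumes "\<gamma> \<in> carrier_vec (1 + r + p + q)" "1 \<le> t"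
  shows "d_eta g r p q x y t \<gamma> j = eta_deriv_rhs t \<gamma> j"
  using eta_has_partial_derivative[OF assms(1)] assms(2)
  by (simp add: d_eta_def partial_deriv_def DERIV_imp_deriv)

text \<open>The index blocks \<open>0\<close>, \<open>1..r\<close>, \<open>r+1..r+p\<close> and
  \<open>r+p+1..r+p+q\<close> are disjoint. Hence only the deltas of the block containing the index
  survive in \<open>eta_deriv_rhs\<close>.\<close>

lemma
  assumes "\<gamma> \<in> carrier_vec (1 + r + p + q)" "1 \<le> t"
  shows d_eta_alpha: "d_eta g r p q x y t \<gamma> 0
      = 1 - (\<Sum>j\<in>{1..q}. theta_coef r p \<gamma> j * d_eta g r p q x y (t - int j) \<gamma> 0)"
    and d_eta_beta: "l < r \<Longrightarrow> d_eta g r p q x y t \<gamma> (1 + l)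
      = x t $ l - (\<Sum>i\<in>{1..p}. phi_coef r \<gamma> i * x (t - int i) $ l)
        - (\<Sum>j\<in>{1..q}. theta_coef r p \<gamma> j * d_eta g r p q x y (t - int j) \<gamma> (1 + l))"
    and d_eta_phi: "k \<in> {1..p} \<Longrightarrow> d_eta g r p q x y t \<gamma> (r + k)
      = g (y (t - int k)) - x (t - int k) \<bullet> beta_coef r \<gamma>
        - (\<Sum>j\<in>{1..q}. theta_coef r p \<gamma> j * d_eta g r p q x y (t - int j) \<gamma> (r + k))"
    and d_eta_theta: "s \<in> {1..q} \<Longrightarrow> d_eta g r p q x y t \<gamma> (r + p + s)
      = resid g r p q x y (t - int s) \<gamma>
        - (\<Sum>i\<in>{1..q}. theta_coef r p \<gamma> i * d_eta g r p q x y (t - int i) \<gamma> (r + p + s))"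
proof -
  note eq = d_eta_eq[OF assms] eta_deriv_rhs_def sum_subtractf
  show "d_eta g r p q x y t \<gamma> 0
      = 1 - (\<Sum>j\<in>{1..q}. theta_coef r p \<gamma> j * d_eta g r p q x y (t - int j) \<gamma> 0)"
    unfolding eq by simp
  show "d_eta g r p q x y t \<gamma> (1 + l)
      = x t $ l - (\<Sum>i\<in>{1..p}. phi_coef r \<gamma> i * x (t - int i) $ l)
        - (\<Sum>j\<in>{1..q}. theta_coef r p \<gamma> j * d_eta g r p q x y (t - int j) \<gamma> (1 + l))" if "l < r"
  proof -
    \<comment> \<open>\<open>f\<close> is general because \<beta> enters twice: through
      \<open>x t\<close> and through each lagged covariate in the autoregressive sum. The other
      deltas vanish since \<open>1 + l \<le> r\<close>.\<close>
    have "(\<Sum>l'<r. f l' * of_bool (1 + l' = 1 + l)) = f l" for f :: "nat \<Rightarrow> real"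
      using that by (simp add: of_bool_def if_distrib sum.delta cong: if_cong)
    moreover have "of_bool (r + i = 1 + l) = (0::real)" if "i \<in> {1..p}" for i
      using that \<open>l < r\<close> by simp
    moreover have "of_bool (r + p + k = 1 + l) = (0::real)" if "k \<in> {1..q}" for k
      using that \<open>l < r\<close> by simp
    ultimately show ?thesis
      unfolding eq by simp
  qed
  show "d_eta g r p q x y t \<gamma> (r + k)
      = g (y (t - int k)) - x (t - int k) \<bullet> beta_coef r \<gamma>
        - (\<Sum>j\<in>{1..q}. theta_coef r p \<gamma> j * d_eta g r p q x y (t - int j) \<gamma> (r + k))"
    if "k \<in> {1..p}"
  proof -
    \<comment> \<open>The three sums compare \<open>r + k\<close> with the \<beta>, \<phi> and
      \<theta> blocks in turn; only the \<phi> block contains it, as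
      \<open>1 \<le> k \<le> p\<close>.\<close>
    have "(\<Sum>l<r. f l * of_bool (1 + l = r + k)) = 0" for f :: "nat \<Rightarrow> real"
      using that by (intro sum.neutral) auto
    moreover have "(\<Sum>i\<in>{1..p}. of_bool (r + i = r + k) * f i) = f k" for f :: "nat \<Rightarrow> real"
      using that by (simp add: of_bool_def if_distrib[of "\<lambda>u. u * _"] sum.delta cong: if_cong)
    moreover have "(\<Sum>i\<in>{1..q}. of_bool (r + p + i = r + k) * f i) = 0" for f :: "nat \<Rightarrow> real"
      using that by (intro sum.neutral) auto
    ultimately show ?thesis
      unfolding eq using that by simp
  qed
  show "d_eta g r p q x y t \<gamma> (r + p + s)
      = resid g r p q x y (t - int s) \<gamma>
        - (\<Sum>i\<in>{1..q}. theta_coef r p \<gamma> i * d_eta g r p q x y (t - int i) \<gamma> (r + p + s))"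
    if "s \<in> {1..q}"
  proof -
    have "(\<Sum>l<r. f l * of_bool (1 + l = r + p + s)) = 0" for f :: "nat \<Rightarrow> real"
      using that by (intro sum.neutral) auto
    moreover have "(\<Sum>i\<in>{1..p}. of_bool (r + i = r + p + s) * f i) = 0" for f :: "nat \<Rightarrow> real"
      using that by (intro sum.neutral) auto
    moreover have "(\<Sum>i\<in>{1..q}. of_bool (r + p + i = r + p + s) * f i) = f s"
      for f :: "nat \<Rightarrow> real"
      using that by (simp add: of_bool_def if_distrib[of "\<lambda>u. u * _"] sum.delta cong: if_cong)
    ultimately show ?thesis
      unfolding eq using that by simp
  qed
qed

section \<open>The chain rule for the log-likelihood and the matrix form of the score\<close>

lemma mu_in: "mu g r p q x y t \<gamma> \<in> {0<..<1}"
  by (simp add: mu_def inv_link_in[OF link, simplified])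

lemma h_eq:
  assumes "y t < 1"
  shows "h g r p q x y t \<gamma>
      = - 2 / (1 - mu g r p q x y t \<gamma>) - 1 / mu g r p q x y t \<gamma>
        + y t / ((mu g r p q x y t \<gamma>)\<^sup>2 * (1 - y t))"
  unfolding h_def using mu_in[of t \<gamma>] assms
  by (intro DERIV_imp_deriv ul_loglik_has_real_derivative) auto

text \<open>Each term is the composition of \<open>ul_loglik (y t)\<close>,
  \<open>inv_link g\<close> and \<open>eta t\<close>. The three chain rule factors are ordered as in
  an entry of D' T h.\<close>

lemma loglik_has_partial_derivative:
  assumes "\<gamma> \<in> carrier_vec (1 + r + p + q)" "\<And>t. y t < 1"
  shows "((\<lambda>s. loglik g r p q x y n (\<gamma> |\<^sub>v j \<mapsto> s)) has_real_derivative
           (\<Sum>t\<in>{1..n}. d_eta g r p q x y (int t) \<gamma> j * (1 / deriv g (mu g r p q x y (int t) \<gamma>))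
              * h g r p q x y (int t) \<gamma>)) (at (\<gamma> $ j))"
  unfolding loglik_def
proof (rule DERIV_sum)
  fix t assume "t \<in> {1..n}"
  then have t: "1 \<le> int t" by simp
  let ?m = "mu g r p q x y (int t)"
  have eta: "((\<lambda>s. eta g r p q x y (int t) (\<gamma> |\<^sub>v j \<mapsto> s)) has_real_derivative
      d_eta g r p q x y (int t) \<gamma> j) (at (\<gamma> $ j))"
    using eta_has_partial_derivative[OF assms(1)] d_eta_eq[OF assms(1) t] by simp
  have mu: "((\<lambda>s. ?m (\<gamma> |\<^sub>v j \<mapsto> s)) has_real_derivative
      1 / deriv g (?m \<gamma>) * d_eta g r p q x y (int t) \<gamma> j) (at (\<gamma> $ j))"
    unfolding mu_def
    by (rule DERIV_chain2[OF _ eta])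
      (simp add: inv_link_has_real_derivative[OF link, simplified])
  have "(ul_loglik (y (int t)) has_real_derivative h g r p q x y (int t) \<gamma>) (at (?m \<gamma>))"
    using ul_loglik_has_real_derivative[of "?m \<gamma>" "y (int t)"] mu_in[of "int t" \<gamma>] assms(2)
    by (simp add: h_eq)
  \<comment> \<open>The base point is written in updated form so that it unifies with the inner
    function in \<open>DERIV_chain2\<close>.\<close>
  then have ll: "(ul_loglik (y (int t)) has_real_derivative h g r p q x y (int t) \<gamma>)
      (at (?m (\<gamma> |\<^sub>v j \<mapsto> (\<gamma> $ j))))"
    by simp
  show "((\<lambda>s. ul_loglik (y (int t)) (?m (\<gamma> |\<^sub>v j \<mapsto> s))) has_real_derivative
      d_eta g r p q x y (int t) \<gamma> j * (1 / deriv g (?m \<gamma>)) * h g r p q x y (int t) \<gamma>) (at (\<gamma> $ j))"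
    using DERIV_chain2[OF ll mu] by (simp add: mult_ac)
qed

text \<open>Multiplication by the diagonal matrix only rescales the columns of D', so the matrix
  product has the shape of the sum produced by the chain rule.\<close>

lemma index_transpose_D_T_h:
  assumes "j < 1 + r + p + q"
  shows "(transpose_mat (D_mat g r p q x y n \<gamma>) * T_mat g r p q x y n \<gamma> *\<^sub>v h_vec g r p q x y n \<gamma>) $ j
    = (\<Sum>t\<in>{1..n}. d_eta g r p q x y (int t) \<gamma> j * (1 / deriv g (mu g r p q x y (int t) \<gamma>))
         * h g r p q x y (int t) \<gamma>)"
proof -
  let ?d = "\<lambda>i. d_eta g r p q x y (int i + 1) \<gamma> j"
  let ?w = "\<lambda>i. 1 / deriv g (mu g r p q x y (int i + 1) \<gamma>)"
  let ?h = "\<lambda>i. h g r p q x y (int i + 1) \<gamma>"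
  have "transpose_mat (D_mat g r p q x y n \<gamma>) * T_mat g r p q x y n \<gamma>
      = mat (1 + r + p + q) n (\<lambda>(j, i). transpose_mat (D_mat g r p q x y n \<gamma>) $$ (j, i) * ?w i)"
    unfolding T_mat_def by (rule mat_diag_mult_right) (simp add: D_mat_def)
  then have "(transpose_mat (D_mat g r p q x y n \<gamma>) * T_mat g r p q x y n \<gamma>
      *\<^sub>v h_vec g r p q x y n \<gamma>) $ j = (\<Sum>i\<in>{0..<n}. ?d i * ?w i * ?h i)"
    using assms by (simp add: scalar_prod_def D_mat_def h_vec_def)
  also have "\<dots> = (\<Sum>t\<in>{1..n}. d_eta g r p q x y (int t) \<gamma> j
      * (1 / deriv g (mu g r p q x y (int t) \<gamma>)) * h g r p q x y (int t) \<gamma>)"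
    \<comment> \<open>Position \<open>i\<close> of the matrices belongs to time
      \<open>i + 1\<close>, hence the witnesses \<open>t - 1\<close> and \<open>Suc\<close>.\<close>
    by (rule sum.reindex_bij_witness[of _ "\<lambda>t. t - 1" Suc]) (auto simp: add.commute)
  finally show ?thesis .
qed

end

section \<open>Score formula and recursions along a sample path\<close>

theorem mainTheorem2:
  fixes M :: "'a measure" and g :: "real \<Rightarrow> real" and r p q n :: nat
    and X :: "int \<Rightarrow> 'a \<Rightarrow> real vec" and Y :: "int \<Rightarrow> 'a \<Rightarrow> real"
    and \<Omega> :: "real vec set" and \<gamma>\<^sub>0 \<gamma> :: "real vec" and \<omega> :: 'a
    and x :: "int \<Rightarrow> real vec" and y :: "int \<Rightarrow> real"
  assumes "1 \<le> n"
    and "\<Omega> \<subseteq> carrier_vec (1 + r + p + q)"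
    and "\<gamma>\<^sub>0 \<in> \<Omega>"
    and "ularma M g r p q X Y \<gamma>\<^sub>0"
    and "\<omega> \<in> space M"
    and "x = (\<lambda>t. X t \<omega>)" and "y = (\<lambda>t. Y t \<omega>)"
    and "\<gamma> \<in> \<Omega>"
  shows
    "(\<forall>j < 1 + r + p + q. partially_differentiable (loglik g r p q x y n) \<gamma> j)
     \<and> score g r p q x y n \<gamma>
         = transpose_mat (D_mat g r p q x y n \<gamma>) * T_mat g r p q x y n \<gamma> *\<^sub>v h_vec g r p q x y n \<gamma>
     \<and> (\<forall>t \<in> {1..int n}.
          ul_loglik (y t) field_differentiable at (mu g r p q x y t \<gamma>) \<and>
          h g r p q x y t \<gamma>
            = - 2 / (1 - mu g r p q x y t \<gamma>) - 1 / mu g r p q x y t \<gamma>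
              + y t / ((mu g r p q x y t \<gamma>)\<^sup>2 * (1 - y t)))
     \<and> (\<forall>t \<ge> 1.
          (\<forall>j < 1 + r + p + q. partially_differentiable (eta g r p q x y t) \<gamma> j) \<and>
          d_eta g r p q x y t \<gamma> 0
            = 1 - (\<Sum>j\<in>{1..q}. theta_coef r p \<gamma> j * d_eta g r p q x y (t - int j) \<gamma> 0) \<and>
          (\<forall>l < r. d_eta g r p q x y t \<gamma> (1 + l)
            = x t $ l - (\<Sum>i\<in>{1..p}. phi_coef r \<gamma> i * x (t - int i) $ l)
              - (\<Sum>j\<in>{1..q}. theta_coef r p \<gamma> j * d_eta g r p q x y (t - int j) \<gamma> (1 + l))) \<and>
          (\<forall>k \<in> {1..p}. d_eta g r p q x y t \<gamma> (r + k)
            = g (y (t - int k)) - x (t - int k) \<bullet> beta_coef r \<gamma>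
              - (\<Sum>j\<in>{1..q}. theta_coef r p \<gamma> j * d_eta g r p q x y (t - int j) \<gamma> (r + k))) \<and>
          (\<forall>s \<in> {1..q}. d_eta g r p q x y t \<gamma> (r + p + s)
            = resid g r p q x y (t - int s) \<gamma>
              - (\<Sum>i\<in>{1..q}. theta_coef r p \<gamma> i * d_eta g r p q x y (t - int i) \<gamma> (r + p + s))))"
proof -
  \<comment> \<open>\<open>\<gamma>\<^sub>0\<close> generates the sample, while
    \<open>\<gamma>\<close> is the point of differentiation. The model supplies the link conditions
    and the bound \<open>Y t \<omega> < 1\<close>; the rest is calculus along the fixed
    path.\<close>
  interpret ularma M g r p q X Y \<gamma>\<^sub>0
    by fact
  have dim: "\<gamma> \<in> carrier_vec (1 + r + p + q)"
    using assms by blast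
  have y: "y t < 1" for t
    using Y_range[OF \<open>\<omega> \<in> space M\<close>] assms by simp
  note ll = loglik_has_partial_derivative[where y = y, OF link dim y]
  have score: "score g r p q x y n \<gamma>
      = transpose_mat (D_mat g r p q x y n \<gamma>) * T_mat g r p q x y n \<gamma> *\<^sub>v h_vec g r p q x y n \<gamma>"
  proof (rule eq_vecI)
    fix j assume "j < dim_vec (transpose_mat (D_mat g r p q x y n \<gamma>) * T_mat g r p q x y n \<gamma>
      *\<^sub>v h_vec g r p q x y n \<gamma>)"
    then have j: "j < 1 + r + p + q"
      by (simp add: D_mat_def)
    then show "score g r p q x y n \<gamma> $ j = (transpose_mat (D_mat g r p q x y n \<gamma>)
        * T_mat g r p q x y n \<gamma> *\<^sub>v h_vec g r p q x y n \<gamma>) $ j"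
      \<comment> \<open>Both sides become the same sum over times, one by matrix algebra and the
        other by the chain rule.\<close>
      unfolding index_transpose_D_T_h[OF link j]
      using DERIV_imp_deriv[OF ll] by (simp add: score_def partial_deriv_def)
  qed (simp add: score_def D_mat_def)
  \<comment> \<open>\<open>deriv\<close> is total, so differentiability is established separately to
    make the partial derivatives genuine.\<close>
  have pd_ll: "partially_differentiable (loglik g r p q x y n) \<gamma> j" for j
    unfolding partially_differentiable_def using ll by (auto simp: field_differentiable_def)
  have pd_eta: "partially_differentiable (eta g r p q x y t) \<gamma> j" for t j
    unfolding partially_differentiable_def
    using eta_has_partial_derivative[where x = x and y = y, OF link dim] by (auto simp: field_differentiable_def)
  have ul: "ul_loglik (y t) field_differentiable at (mu g r p q x y t \<gamma>)" for t
    using ul_loglik_has_real_derivative[of "mu g r p q x y t \<gamma>" "y t"] y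
      mu_in[OF link, of r p q x y t \<gamma>]
    by (auto simp: field_differentiable_def)
  show ?thesis
    by (intro conjI allI ballI impI score pd_ll pd_eta ul h_eq[where y = y, OF link y]
        d_eta_alpha[OF link dim] d_eta_beta[OF link dim] d_eta_phi[OF link dim]
        d_eta_theta[OF link dim])
qed

end
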